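(* Let $g\in\mathbb{G}$ and let $c\in[0,1]$ be a dyadic number. Then the point $(c,g(c))$ is preperiodic under the diagonal action $(x,y)\mapsto(g(x),g(y))$ on $[0,1]\times[0,1]$; that is, there exist integers $n>m\ge 0$ such that the $n$-th and $m$-th iterates of this action coincide at $(c,g(c))$.
   Context: $\lambda$ is Lebesgue measure on $[0,1]$. A continuous map $h:[0,1]\to[0,1]$ is $\lambda$-preserving if $\lambda(A)=\lambda(h^{-1}(A))$ for every Borel set $A\subseteq[0,1]$. A dyadic number is a rational number whose denominator is an integer power of $2$. $\mathbb{G}$ ($\lambda$-preserving Thompson's monoid) is the set of continuous maps $g$ from $[0,1]$ onto $[0,1]$ such that: $g$ is $\lambda$-preserving; $g$ is piecewise affine; $g$ is differentiable except at finitely many points; the $x$-coordinate of each point of non-differentiability is dyadic; and on every interval where $g$ is differentiable, the derivative is of the form $\pm 2^k$ with $k\in\mathbb{Z}$. A point $x$ is preperiodic for a map $h$ if $h^n(x)=h^m(x)$ for some integers $n>m\ge0$ (the case $m=0$ being the periodic case). *)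

theory Defs
  imports "HOL-Analysis.Analysis"
begin

text \<open>
  Self-maps of the unit interval are represented by functions on all of \<open>real\<close>; only the values
  on \<open>{0..1}\<close> are constrained, and preimages and derivatives are taken relative to \<open>{0..1}\<close>.
\<close>

definition unit_lebesgue :: "real measure" where
  "unit_lebesgue = restrict_space lborel {0..1}"

definition lambda_preserving :: "(real \<Rightarrow> real) \<Rightarrow> bool" where
  "lambda_preserving h \<longleftrightarrow>
     (\<forall>A \<in> sets borel. A \<subseteq> {0..1} \<longrightarrow>
        emeasure unit_lebesgue A = emeasure unit_lebesgue (h -` A \<inter> {0..1}))"

definition piecewise_affine :: "(real \<Rightarrow> real) \<Rightarrow> bool" where
  "piecewise_affine g \<longleftrightarrow>
     (\<exists>(n::nat) (p :: nat \<Rightarrow> real). p 0 = 0 \<and> p n = 1 \<and> (\<forall>i<n. p i < p (Suc i)) \<and>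
        (\<forall>i<n. \<exists>a b. \<forall>x \<in> {p i..p (Suc i)}. g x = a * x + b))"

text \<open>At the endpoints \<open>0\<close> and \<open>1\<close>, differentiability within \<open>{0..1}\<close> is one-sided.\<close>

definition nondiff_points :: "(real \<Rightarrow> real) \<Rightarrow> real set" where
  "nondiff_points g = {x \<in> {0..1}. \<not> g differentiable (at x within {0..1})}"

text \<open>
  The library set \<^const>\<open>dyadics\<close> consists of the nonnegative dyadic numbers only; this makes no
  difference for points of \<open>{0..1}\<close>.
\<close>

definition lambda_Thompson_monoid :: "(real \<Rightarrow> real) set" where
  "lambda_Thompson_monoid = {g.
     continuous_on {0..1} g \<and> g ` {0..1} = {0..1} \<and>
     lambda_preserving g \<and>
     piecewise_affine g \<and>
     finite (nondiff_points g) \<and>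
     nondiff_points g \<subseteq> dyadics \<and>
     (\<forall>J. is_interval J \<and> J \<subseteq> {0..1} \<and> J \<inter> nondiff_points g = {} \<longrightarrow>
        (\<exists>k::int. \<exists>s \<in> {1, -1}. \<forall>x \<in> J.
           (g has_real_derivative s * 2 powi k) (at x within {0..1})))}"

definition preperiodic :: "('a \<Rightarrow> 'a) \<Rightarrow> 'a \<Rightarrow> bool" where
  "preperiodic h x \<longleftrightarrow> (\<exists>n m::nat. n > m \<and> (h ^^ n) x = (h ^^ m) x)"

definition diagonal_action :: "('a \<Rightarrow> 'a) \<Rightarrow> 'a \<times> 'a \<Rightarrow> 'a \<times> 'a" where
  "diagonal_action g = (\<lambda>(x, y). (g x, g y))"

end

theory Submission
  imports Defs
begin

text \<open>
  Preservation of \<open>\<lambda>\<close> forbids slopes of modulus below \<open>1\<close>, so all slopes are integers. Hence for any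
  \<open>M\<close> such that the grid \<open>2\<^sup>-\<^sup>M\<int>\<close> contains all breakpoints, \<open>g\<close> changes by a multiple of \<open>2\<^sup>-\<^sup>M\<close>
  between neighbouring grid points. As \<open>g\<close> is onto, it takes the value \<open>0\<close>; this happens at a
  breakpoint or an endpoint, because \<open>g'\<close> vanishes nowhere. So \<open>g\<close> maps the finite set of grid points
  of \<open>{0..1}\<close> to itself, and choosing \<open>M\<close> such that \<open>c\<close> is a grid point, the orbit of \<open>c\<close> is finite.
\<close>

text \<open>Unlike \<open>dyadics\<close>, the grid contains negative numbers, so it is closed under
  differences; increments of \<open>g\<close> can have either sign.\<close>

definition dyadic_grid :: "nat \<Rightarrow> real set" where
  "dyadic_grid M = {x. x * 2 ^ M \<in> \<int>}"

lemma dyadic_grid_mono: "M \<le> N \<Longrightarrow> dyadic_grid M \<subseteq> dyadic_grid N"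
proof
  fix x assume "M \<le> N" "x \<in> dyadic_grid M"
  then have "x * 2 ^ M * 2 ^ (N - M) \<in> \<int>"
    by (auto simp: dyadic_grid_def)
  then show "x \<in> dyadic_grid N"
    using \<open>M \<le> N\<close> by (simp add: dyadic_grid_def mult.assoc flip: power_add)
qed

lemma dyadic_grid_add: "x \<in> dyadic_grid M \<Longrightarrow> y \<in> dyadic_grid M \<Longrightarrow> x + y \<in> dyadic_grid M"
  by (simp add: dyadic_grid_def distrib_right)

lemma dyadic_grid_diff: "x \<in> dyadic_grid M \<Longrightarrow> y \<in> dyadic_grid M \<Longrightarrow> x - y \<in> dyadic_grid M"
  by (simp add: dyadic_grid_def left_diff_distrib)

lemma dyadics_subset_dyadic_grid:
  assumes "finite S" "S \<subseteq> (dyadics :: real set)"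
  shows "\<exists>M. S \<subseteq> dyadic_grid M"
  using assms
proof (induction S rule: finite_induct)
  case (insert x S)
  then obtain M where M: "S \<subseteq> dyadic_grid M" by auto
  from insert obtain k m where x: "x = of_nat m / 2 ^ k"
    by (auto simp: dyadics_def)
  then have "x \<in> dyadic_grid k" by (simp add: dyadic_grid_def)
  then have "insert x S \<subseteq> dyadic_grid (max k M)"
    using M dyadic_grid_mono[of k "max k M"] dyadic_grid_mono[of M "max k M"] by auto
  then show ?case ..
qed auto

lemma finite_dyadic_grid_Icc: "finite (dyadic_grid M \<inter> {a..b})"
proof -
  have "dyadic_grid M \<inter> {a..b} \<subseteq> (\<lambda>i. of_int i / 2 ^ M) ` {\<lfloor>a * 2 ^ M\<rfloor>..\<lfloor>b * 2 ^ M\<rfloor>}"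
  proof
    fix x assume x: "x \<in> dyadic_grid M \<inter> {a..b}"
    then obtain i where i: "x * 2 ^ M = of_int i"
      by (auto simp: dyadic_grid_def elim: Ints_cases)
    have "a * 2 ^ M \<le> x * 2 ^ M" "x * 2 ^ M \<le> b * 2 ^ M" using x by auto
    then have "i \<in> {\<lfloor>a * 2 ^ M\<rfloor>..\<lfloor>b * 2 ^ M\<rfloor>}"
      unfolding i by (auto simp: le_floor_iff floor_le_iff)
    moreover have "x = of_int i / 2 ^ M" using i by (simp add: field_simps)
    ultimately show "x \<in> (\<lambda>i. of_int i / 2 ^ M) ` {\<lfloor>a * 2 ^ M\<rfloor>..\<lfloor>b * 2 ^ M\<rfloor>}" by blast
  qed
  then show ?thesis by (rule finite_subset) simp
qed

text \<open>Pigeonhole: the orbit stays in the finite set \<open>S\<close>, so two iterates must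
  coincide.\<close>

lemma preperiodic_finite_invariant:
  assumes "finite S" "h ` S \<subseteq> S" "x \<in> S"
  shows "preperiodic h x"
proof -
  have "(h ^^ n) x \<in> S" for n
    using assms by (induction n) auto
  then have "finite (range (\<lambda>n. (h ^^ n) x))"
    by (intro finite_subset[OF _ \<open>finite S\<close>]) auto
  then have "\<not> inj (\<lambda>n. (h ^^ n) x)"
    using finite_imageD by fastforce
  then obtain n m where "n \<noteq> m" "(h ^^ n) x = (h ^^ m) x"
    by (auto simp: inj_def)
  then show ?thesis
    unfolding preperiodic_def by (metis linorder_neqE_nat)
qed

text \<open>The mean value theorem needs only continuity at the ends of the interval, so
  \<open>a\<close> and \<open>b\<close> may be breakpoints.\<close>

lemma increment_of_constant_derivative:
  fixes g :: "real \<Rightarrow> real"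
  assumes "continuous_on {a..b} g" "a \<le> x" "x \<le> y" "y \<le> b"
    and "\<And>z. z \<in> {a<..<b} \<Longrightarrow> (g has_real_derivative d) (at z)"
  shows "g y - g x = d * (y - x)"
proof (cases "x < y")
  case True
  have "continuous_on {x..y} g"
    by (rule continuous_on_subset[OF assms(1)]) (use assms in auto)
  moreover have "(g has_derivative (\<lambda>h. d * h)) (at z)" if "x < z" "z < y" for z
    using assms(5)[of z] that assms by (simp add: has_field_derivative_def)
  ultimately show ?thesis
    using mvt[OF True, of g "\<lambda>_ h. d * h"] by auto
qed (use assms in auto)

lemma emeasure_unit_lebesgue_Icc:
  "0 \<le> a \<Longrightarrow> a \<le> b \<Longrightarrow> b \<le> 1 \<Longrightarrow> emeasure unit_lebesgue {a..b} = ennreal (b - a)"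
  unfolding unit_lebesgue_def by (subst emeasure_restrict_space) auto

text \<open>The image \<open>{u..v}\<close> of \<open>{a..b}\<close> has length at most
  \<open>\<bar>d\<bar> * (b - a)\<close>, while its preimage contains \<open>{a..b}\<close> and has
  the same measure as \<open>{u..v}\<close>. Hence \<open>b - a\<close> is at most
  \<open>\<bar>d\<bar> * (b - a)\<close>.\<close>

lemma lambda_preserving_slope_ge_1:
  fixes g :: "real \<Rightarrow> real"
  assumes cont: "continuous_on {0..1} g" and img: "g ` {0..1} \<subseteq> {0..1}"
    and pres: "lambda_preserving g"
    and ab: "0 \<le> a" "a < b" "b \<le> 1"
    and der: "\<And>z. z \<in> {a<..<b} \<Longrightarrow> (g has_real_derivative d) (at z)"
  shows "1 \<le> \<bar>d\<bar>"
proof -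
  have cont_ab: "continuous_on {a..b} g"
    by (rule continuous_on_subset[OF cont]) (use ab in auto)
  then obtain u v where uv: "g ` {a..b} = {u..v}" "u \<le> v"
    using continuous_image_closed_interval[of a b g] ab by auto
  have "{u..v} \<subseteq> {0..1}"
    using img ab image_mono[of "{a..b}" "{0..1}" g] unfolding uv(1)[symmetric] by auto
  then have uv01: "0 \<le> u" "v \<le> 1" using \<open>u \<le> v\<close> by auto
  obtain x y where xy: "x \<in> {a..b}" "y \<in> {a..b}" "u = g x" "v = g y"
    using uv by (metis atLeastAtMost_iff imageE order_refl)
  \<comment> \<open>The minimum point \<open>x\<close> may lie on either side of the maximum point
    \<open>y\<close>, depending on the sign of \<open>d\<close>.\<close>
  have "v - u = d * (y - x)"
    using increment_of_constant_derivative[OF cont_ab _ _ _ der, of x y]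
      increment_of_constant_derivative[OF cont_ab _ _ _ der, of y x] xy
    by (cases "x \<le> y") (auto simp: algebra_simps)
  also have "\<dots> \<le> \<bar>d\<bar> * \<bar>y - x\<bar>" by (metis abs_ge_self abs_mult)
  also have "\<dots> \<le> \<bar>d\<bar> * (b - a)" using xy by (intro mult_left_mono) auto
  finally have le: "v - u \<le> \<bar>d\<bar> * (b - a)" .
  \<comment> \<open>Monotonicity of the measure requires the larger set, here the preimage, to be
    measurable.\<close>
  have "closed (g -` {u..v} \<inter> {0..1})"
    using continuous_closed_preimage[OF cont, of "{u..v}"] by (simp add: Int_commute)
  then have "g -` {u..v} \<inter> {0..1} \<in> sets unit_lebesgue"
    unfolding unit_lebesgue_def by (subst sets_restrict_space_iff) auto
  then have "emeasure unit_lebesgue {a..b} \<le> emeasure unit_lebesgue (g -` {u..v} \<inter> {0..1})"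
    using uv(1) ab by (intro emeasure_mono) auto
  also have "\<dots> = emeasure unit_lebesgue {u..v}"
    using pres \<open>{u..v} \<subseteq> {0..1}\<close> unfolding lambda_preserving_def by simp
  finally have "b - a \<le> v - u"
    using ab uv01 uv(2) by (simp add: emeasure_unit_lebesgue_Icc)
  with le have "1 * (b - a) \<le> \<bar>d\<bar> * (b - a)" by simp
  then show ?thesis using ab by (subst (asm) mult_le_cancel_right_pos) auto
qed

text \<open>Keeping \<open>J\<close> away from 0 and 1 turns derivatives within
  \<open>{0..1}\<close> into ordinary ones.\<close>

lemma Thompson_monoid_has_derivative:
  assumes "g \<in> lambda_Thompson_monoid"
    and "is_interval J" "J \<subseteq> {0<..<1}" "J \<inter> nondiff_points g = {}"
  obtains k :: int and s :: real where "s \<in> {1, -1}"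
    "\<And>x. x \<in> J \<Longrightarrow> (g has_real_derivative s * 2 powi k) (at x)"
proof -
  have "J \<subseteq> {0..1}" using assms(3) by auto
  then obtain k :: int and s :: real where ks: "s \<in> {1, -1}"
    "\<forall>x \<in> J. (g has_real_derivative s * 2 powi k) (at x within {0..1})"
    using assms unfolding lambda_Thompson_monoid_def by blast
  moreover have "at x within {0..1} = at x" if "x \<in> J" for x :: real
    using that assms(3) by (intro at_within_Icc_at) auto
  ultimately show ?thesis using that by (metis (no_types, lifting))
qed

lemma Thompson_monoid_step:
  assumes g: "g \<in> lambda_Thompson_monoid"
    and nd: "nondiff_points g \<subseteq> dyadic_grid M"
    and j: "j < 2 ^ M"
  shows "g (real (Suc j) / 2 ^ M) - g (real j / 2 ^ M) \<in> dyadic_grid M"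
proof -
  define a b where "a = real j / 2 ^ M" and "b = real (Suc j) / 2 ^ M"
  have "real (Suc j) \<le> 2 ^ M"
    using j by (metis Suc_leI of_nat_le_iff of_nat_numeral of_nat_power)
  then have ab: "0 \<le> a" "a < b" "b \<le> 1" "b - a = 1 / 2 ^ M"
    by (auto simp: a_def b_def field_simps)
  \<comment> \<open>All breakpoints are grid points, so a cell without interior grid points carries
    a single slope.\<close>
  have "{a<..<b} \<inter> dyadic_grid M = {}"
  proof (rule ccontr)
    assume "{a<..<b} \<inter> dyadic_grid M \<noteq> {}"
    then obtain x where x: "a < x" "x < b" "x * 2 ^ M \<in> \<int>"
      by (auto simp: dyadic_grid_def)
    then obtain i where i: "x * 2 ^ M = of_int i"
      by (auto elim: Ints_cases)
    from x(1,2) have "of_int (int j) < x * 2 ^ M" "x * 2 ^ M < of_int (int (Suc j))"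
      by (simp_all add: a_def b_def field_simps)
    then have "int j < i" "i < int (Suc j)" unfolding i of_int_less_iff by auto
    then show False by simp
  qed
  then have disj: "{a<..<b} \<inter> nondiff_points g = {}" using nd by auto
  obtain k :: int and s :: real where s: "s \<in> {1, -1}"
    and der: "\<And>x. x \<in> {a<..<b} \<Longrightarrow> (g has_real_derivative s * 2 powi k) (at x)"
    by (rule Thompson_monoid_has_derivative[OF g is_interval_oo _ disj]) (use ab in auto)
  have cont: "continuous_on {0..1} g"
    using g by (simp add: lambda_Thompson_monoid_def)
  have "1 \<le> \<bar>s * 2 powi k\<bar>"
    using g ab by (intro lambda_preserving_slope_ge_1[OF _ _ _ _ _ _ der])
      (auto simp: lambda_Thompson_monoid_def)
  then have "(1::real) \<le> 2 powi k" using s by auto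
  then have "0 \<le> k"
    using power_int_strict_increasing[of k 0 "2 :: real"] by (cases "k < 0") auto
  then have "s * 2 powi k \<in> \<int>"
    using s by (auto simp: power_int_def)
  moreover have "g b - g a = s * 2 powi k * (b - a)"
    using ab by (intro increment_of_constant_derivative[OF _ _ _ _ der]
        continuous_on_subset[OF cont]) auto
  ultimately show ?thesis
    using ab by (fold a_def b_def) (simp add: dyadic_grid_def)
qed

text \<open>The increments over neighbouring cells telescope. Only differences are controlled here:
  whether \<open>g 0\<close> is itself a grid point is still open.\<close>

lemma Thompson_monoid_diff:
  assumes g: "g \<in> lambda_Thompson_monoid"
    and nd: "nondiff_points g \<subseteq> dyadic_grid M"
    and x: "x \<in> dyadic_grid M \<inter> {0..1}"
  shows "g x - g 0 \<in> dyadic_grid M"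
proof -
  have *: "j \<le> 2 ^ M \<Longrightarrow> g (real j / 2 ^ M) - g 0 \<in> dyadic_grid M" for j
  proof (induction j)
    case (Suc j)
    then show ?case
      using dyadic_grid_add[OF Thompson_monoid_step[OF g nd, of j], of "g (real j / 2 ^ M) - g 0"]
      by simp
  qed (simp add: dyadic_grid_def)
  obtain i where i: "x * 2 ^ M = of_int i"
    using x by (auto simp: dyadic_grid_def elim: Ints_cases)
  have "0 \<le> x * 2 ^ M" "x * 2 ^ M \<le> 2 ^ M" using x by auto
  then have "0 \<le> i" "real_of_int i \<le> 2 ^ M" unfolding i by auto
  then obtain j where j: "i = int j" "j \<le> 2 ^ M"
    by (metis nonneg_int_cases of_int_of_nat_eq of_nat_le_iff of_nat_numeral of_nat_power)
  have "x = real j / 2 ^ M" using i j by (simp add: field_simps)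
  then show ?thesis using *[of j] j by simp
qed

text \<open>A zero of \<open>g\<close> is a minimum on \<open>{0..1}\<close>. At an interior point
  of differentiability the derivative would vanish there, which \<plusminus>\<open>2 powi k\<close>
  never does.\<close>

lemma Thompson_monoid_zero:
  assumes g: "g \<in> lambda_Thompson_monoid" and nd: "nondiff_points g \<subseteq> dyadic_grid M"
  shows "\<exists>x \<in> dyadic_grid M \<inter> {0..1}. g x = 0"
proof -
  have img: "g ` {0..1} = {0..1}" using g by (simp add: lambda_Thompson_monoid_def)
  then obtain x where x: "x \<in> {0..1}" "g x = 0"
    by (metis atLeastAtMost_iff imageE order_refl zero_le_one)
  have "x \<in> dyadic_grid M"
  proof (rule ccontr)
    assume "x \<notin> dyadic_grid M"
    then have "x \<noteq> 0" "x \<noteq> 1" "x \<notin> nondiff_points g"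
      using nd by (auto simp: dyadic_grid_def)
    then have x01: "0 < x" "x < 1" "{x} \<inter> nondiff_points g = {}" using x by auto
    \<comment> \<open>The slope condition is applied to the degenerate interval
      \<open>{x}\<close>.\<close>
    obtain k :: int and s :: real where "s \<in> {1, -1}"
      "(g has_real_derivative s * 2 powi k) (at x)"
      by (rule Thompson_monoid_has_derivative[OF g, of "{x}"])
        (use x01 is_interval_cc[of x x] in auto)
    \<comment> \<open>This radius keeps \<open>y\<close> inside \<open>{0..1}\<close>, where
      \<open>g\<close> is nonnegative.\<close>
    moreover have "\<forall>y. \<bar>x - y\<bar> < min x (1 - x) \<longrightarrow> g x \<le> g y"
    proof (intro allI impI)
      fix y assume "\<bar>x - y\<bar> < min x (1 - x)"
      then have "y \<in> {0..1}" by auto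
      then have "g y \<in> {0..1}" using img by blast
      then show "g x \<le> g y" using x by simp
    qed
    ultimately have "s * 2 powi k = 0"
      using x01 by (intro DERIV_local_min[of g _ x "min x (1 - x)"]) auto
    then show False using \<open>s \<in> {1, -1}\<close> by auto
  qed
  with x show ?thesis by blast
qed

lemma Thompson_monoid_dyadic_grid:
  assumes g: "g \<in> lambda_Thompson_monoid" and nd: "nondiff_points g \<subseteq> dyadic_grid M"
  shows "g ` (dyadic_grid M \<inter> {0..1}) \<subseteq> dyadic_grid M \<inter> {0..1}"
proof
  fix y assume "y \<in> g ` (dyadic_grid M \<inter> {0..1})"
  then obtain x where x: "x \<in> dyadic_grid M \<inter> {0..1}" "y = g x" by blast
  obtain z where z: "z \<in> dyadic_grid M \<inter> {0..1}" "g z = 0"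
    using Thompson_monoid_zero[OF g nd] by blast
  \<comment> \<open>The unknown \<open>g 0\<close> cancels and \<open>g z = 0\<close>, which leaves
    \<open>g x\<close>.\<close>
  have "(g x - g 0) - (g z - g 0) \<in> dyadic_grid M"
    using x z by (intro dyadic_grid_diff Thompson_monoid_diff[OF g nd])
  moreover have "g x \<in> {0..1}"
    using g x(1) unfolding lambda_Thompson_monoid_def by blast
  ultimately show "y \<in> dyadic_grid M \<inter> {0..1}" using x z by simp
qed

lemma diagonal_action_funpow: "(diagonal_action h ^^ n) (x, y) = ((h ^^ n) x, (h ^^ n) y)"
  by (induction n) (auto simp: diagonal_action_def)

text \<open>The second coordinate follows the orbit of \<open>x\<close> one step ahead, so the same
  \<open>n\<close> and \<open>m\<close> work for both coordinates.\<close>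

lemma preperiodic_diagonal_action:
  "preperiodic h x \<Longrightarrow> preperiodic (diagonal_action h) (x, h x)"
  unfolding preperiodic_def diagonal_action_funpow prod.inject
  by (elim exE conjE, intro exI conjI) (assumption, simp_all flip: funpow_swap1)

theorem theorem11:
  fixes g :: "real \<Rightarrow> real" and c :: real
  assumes "g \<in> lambda_Thompson_monoid"
    and "c \<in> {0..1}" and "c \<in> dyadics"
  shows "preperiodic (diagonal_action g) (c, g c)"
proof -
  have "finite (insert c (nondiff_points g))" "insert c (nondiff_points g) \<subseteq> dyadics"
    using assms by (auto simp: lambda_Thompson_monoid_def)
  then obtain M where "insert c (nondiff_points g) \<subseteq> dyadic_grid M"
    using dyadics_subset_dyadic_grid by blast
  then have "preperiodic g c"
    using assms by (intro preperiodic_finite_invariant[OF finite_dyadic_grid_Icc[of M 0 1]]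
        Thompson_monoid_dyadic_grid) auto
  then show ?thesis by (rule preperiodic_diagonal_action)
qed

end
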